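(* Let $(\underline x,B,L,G)$ be a graded quantum seed. Then the quantum cluster algebra $\mathcal A_q(\underline x,B,L,G)$ associated to this initial graded quantum seed is a $\mathbb{Z}$-graded algebra, where each quantum cluster variable is assigned the degree obtained by propagating $G$ through mutation.
   Context: $\mathbb{K}=\mathbb{Q}(q^{1/2})$. A quantum seed $(\underline{x},B,L)$ of cardinality $r$, with a fixed subset of $\{1,\dots,r\}$ of mutable indices (the others are frozen), consists of: a skew-symmetric integer matrix $L=(l_{ij})$; a tuple $\underline{x}=(X_1,\dots,X_r)$ generating, as a skew-field over $\mathbb{K}$, the skew-field of fractions $\mathcal F$ of the quantum torus with generators $X_i^{\pm1}$ and relations $X_iX_j=q^{l_{ij}}X_jX_i$; and a skew-symmetric integer $r\times r$ matrix $B=(b_{ij})$ with $b_{ij}=0$ if $i,j$ are both frozen, compatible with $L$: for some positive integer $d$, $\sum_k b_{ki}l_{kj}=d\delta_{ij}$ for all mutable $i$ and all $j$. For $\underline a\in\mathbb{Z}^r$ put $M(\underline a)=q^{\frac12\sum_{i<j}a_ia_jl_{ji}}X_1^{a_1}\cdots X_r^{a_r}$. For mutable $k$ put $\underline b_k^+=-\underline e_k+\sum_{b_{ik}>0}b_{ik}\underline e_i$, $\underline b_k^-=-\underline e_k-\sum_{b_{ik}<0}b_{ik}\underline e_i$. Mutation in direction $k$ replaces $X_k$ by $X_k'=M(\underline b_k^+)+M(\underline b_k^-)$, leaves the other $X_i$ unchanged, and replaces $B,L$ by $EBE^T$ (entries with both indices frozen reset to $0$) and $E^TLE$, where $E_{rs}=\delta_{rs}$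 if $s\ne k$, $E_{kk}=-1$, $E_{rk}=\max(0,-b_{rk})$ if $r\neq k$. The quantum cluster variables are all entries (including frozen ones) of all seeds obtained from the initial one by iterated mutation; the quantum cluster algebra $\mathcal A_q(\underline x,B,L)$ is the $\mathbb{K}$-subalgebra of $\mathcal F$ they generate. A graded quantum seed is $(\underline x,B,L,G)$ where $(\underline x,B,L)$ is a quantum seed and $G\in\mathbb{Z}^r$ satisfies $B_iG=0$ for every mutable $i$ ($B_i$ the $i$th row of $B$); one sets $\deg X_i=G_i$, and $\mathcal A_q(\underline x,B,L,G)$ denotes the associated quantum cluster algebra. Gradings mutate along with seeds: under mutation in direction $k$, $G'_i=G_i$ for $i\ne k$ and $G_k'=\underline b_k^-\cdot G=\underline b_k^+\cdot G$ (the common degree of $M(\underline b_k^{\pm})$), and $\deg X_i'=G_i'$ for the entries of the mutated cluster. *)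

theory Defs
  imports
    "HOL-Analysis.Cartesian_Space"
    "HOL-Computational_Algebra.Polynomial"
    "HOL-Computational_Algebra.Fraction_Field"
begin

(* The ground field Q(t) with t = q^(1/2). *)
type_synonym ground = "rat poly fract"

definition qhalf :: ground
  where "qhalf = Fract [:0, 1:] 1"

(* qpow n is q^n for an integer n; odd powers of q^(1/2) are written with qhalf directly. *)
definition qpow :: "int \<Rightarrow> ground"
  where "qpow n = qhalf powi (2 * n)"


(* An associative unital algebra over the ground field that is a division ring.
   Notions from linear algebra (subspaces, linear dependence) are those of the library,
   at the scalar multiplication scl. *)
locale skew_field_algebra = vector_space scl
  for scl :: "ground \<Rightarrow> 'f::division_ring \<Rightarrow> 'f" +
  assumes mult_scale_left: "scl c x * y = scl c (x * y)"
    and mult_scale_right: "x * scl c y = scl c (x * y)"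

definition is_subalgebra :: "(ground \<Rightarrow> 'f::division_ring \<Rightarrow> 'f) \<Rightarrow> 'f set \<Rightarrow> bool"
  where "is_subalgebra scl A \<longleftrightarrow>
    module.subspace scl A \<and> 1 \<in> A \<and> (\<forall>x\<in>A. \<forall>y\<in>A. x * y \<in> A)"

definition generated_subalgebra :: "(ground \<Rightarrow> 'f::division_ring \<Rightarrow> 'f) \<Rightarrow> 'f set \<Rightarrow> 'f set"
  where "generated_subalgebra scl V = is_subalgebra scl hull V"

(* gr is a family of subspaces of A with A = (direct sum of the gr d) and
   gr d * gr e contained in gr (d + e). *)
definition is_Z_grading ::
    "(ground \<Rightarrow> 'f::division_ring \<Rightarrow> 'f) \<Rightarrow> 'f set \<Rightarrow> (int \<Rightarrow> 'f set) \<Rightarrow> bool"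
  where "is_Z_grading scl A gr \<longleftrightarrow>
    (\<forall>d. module.subspace scl (gr d) \<and> gr d \<subseteq> A) \<and>
    (\<forall>x\<in>A. \<exists>!f. (\<forall>d. f d \<in> gr d) \<and> finite {d. f d \<noteq> 0} \<and> x = (\<Sum>d | f d \<noteq> 0. f d)) \<and>
    (\<forall>d e. \<forall>x\<in>gr d. \<forall>y\<in>gr e. x * y \<in> gr (d + e))"


(* The index set {1..r} is a finite linearly ordered type 'n. *)
type_synonym 'n zvec = "(int, 'n) vec"
type_synonym 'n zmat = "('n zvec, 'n) vec"

definition ordered_monomial :: "('n::{finite,linorder} \<Rightarrow> 'f::division_ring) \<Rightarrow> 'n zvec \<Rightarrow> 'f"
  where "ordered_monomial X a =
    prod_list (map (\<lambda>i. X i powi (a $ i)) (sorted_list_of_set UNIV))"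

definition torus_part ::
    "(ground \<Rightarrow> 'f::division_ring \<Rightarrow> 'f) \<Rightarrow> ('n \<Rightarrow> 'f) \<Rightarrow> 'f set"
  where "torus_part scl X = generated_subalgebra scl (range X \<union> range (\<lambda>i. inverse (X i)))"

(* The quantum torus on X_i^(+-1) with X_i X_j = q^(l_ij) X_j X_i has the ordered monomials as
   a basis. Hence the first four conditions say that the subalgebra generated by the X_i^(+-1)
   is the quantum torus on these generators; the last one says that the whole division ring
   is its skew-field of fractions, and so in particular is generated by the X_i. *)
definition quantum_torus_fractions ::
    "(ground \<Rightarrow> 'f::division_ring \<Rightarrow> 'f) \<Rightarrow> ('n::{finite,linorder} \<Rightarrow> 'f) \<Rightarrow> 'n zmat \<Rightarrow> bool"
  where "quantum_torus_fractions scl X L \<longleftrightarrow>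
    (\<forall>i. X i \<noteq> 0) \<and>
    (\<forall>i j. X i * X j = scl (qpow (L $ i $ j)) (X j * X i)) \<and>
    inj (ordered_monomial X) \<and>
    \<not> module.dependent scl (range (ordered_monomial X)) \<and>
    (\<forall>z. \<exists>x\<in>torus_part scl X. \<exists>y\<in>torus_part scl X. y \<noteq> 0 \<and> z = x * inverse y)"


record ('n::finite, 'f) qseed =
  cluster :: "'n \<Rightarrow> 'f"
  exmat :: "'n zmat"    (* B *)
  commat :: "'n zmat"   (* L *)

definition compatible :: "'n::finite set \<Rightarrow> 'n zmat \<Rightarrow> 'n zmat \<Rightarrow> bool"
  where "compatible mut B L \<longleftrightarrow>
    (\<exists>d>0. \<forall>i\<in>mut. \<forall>j. (\<Sum>k\<in>UNIV. B $ k $ i * L $ k $ j) = (if i = j then d else 0))"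

(* mut is the set of mutable indices. *)
definition quantum_seed ::
    "(ground \<Rightarrow> 'f::division_ring \<Rightarrow> 'f) \<Rightarrow> 'n::{finite,linorder} set \<Rightarrow> ('n, 'f) qseed \<Rightarrow> bool"
  where "quantum_seed scl mut S \<longleftrightarrow>
    transpose (commat S) = - commat S \<and>
    quantum_torus_fractions scl (cluster S) (commat S) \<and>
    transpose (exmat S) = - exmat S \<and>
    (\<forall>i j. i \<notin> mut \<longrightarrow> j \<notin> mut \<longrightarrow> exmat S $ i $ j = 0) \<and>
    compatible mut (exmat S) (commat S)"

definition toric_frame ::
    "(ground \<Rightarrow> 'f::division_ring \<Rightarrow> 'f) \<Rightarrow> ('n::{finite,linorder}, 'f) qseed \<Rightarrow> 'n zvec \<Rightarrow> 'f"
  where "toric_frame scl S a =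
    scl (qhalf powi (\<Sum>(i, j) | i < j. a $ i * a $ j * commat S $ j $ i))
      (ordered_monomial (cluster S) a)"

definition b_plus :: "'n zmat \<Rightarrow> 'n::finite \<Rightarrow> 'n zvec"
  where "b_plus B k = - axis k 1 + (\<Sum>i | B $ i $ k > 0. axis i (B $ i $ k))"

definition b_minus :: "'n zmat \<Rightarrow> 'n::finite \<Rightarrow> 'n zvec"
  where "b_minus B k = - axis k 1 - (\<Sum>i | B $ i $ k < 0. axis i (B $ i $ k))"

definition mutE :: "'n zmat \<Rightarrow> 'n::finite \<Rightarrow> 'n zmat"
  where "mutE B k =
    (\<chi> i j. if j \<noteq> k then (if i = j then 1 else 0)
           else if i = k then - 1 else max 0 (- B $ i $ k))"

definition mutate ::
    "(ground \<Rightarrow> 'f::division_ring \<Rightarrow> 'f) \<Rightarrow> 'n::{finite,linorder} set \<Rightarrow> 'n \<Rightarrow>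
      ('n, 'f) qseed \<Rightarrow> ('n, 'f) qseed"
  where "mutate scl mut k S =
    (let B = exmat S; L = commat S; E = mutE B k; B' = E ** B ** transpose E in
     \<lparr> cluster = (cluster S)
         (k := toric_frame scl S (b_plus B k) + toric_frame scl S (b_minus B k)),
       exmat = (\<chi> i j. if i \<notin> mut \<and> j \<notin> mut then 0 else B' $ i $ j),
       commat = transpose E ** L ** E \<rparr>)"

inductive_set mutation_class ::
    "(ground \<Rightarrow> 'f::division_ring \<Rightarrow> 'f) \<Rightarrow> 'n::{finite,linorder} set \<Rightarrow> ('n, 'f) qseed \<Rightarrow>
      ('n, 'f) qseed set"
  for scl mut S where
    initial: "S \<in> mutation_class scl mut S"
  | step: "T \<in> mutation_class scl mut S \<Longrightarrow> k \<in> mut \<Longrightarrow>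
      mutate scl mut k T \<in> mutation_class scl mut S"

definition quantum_cluster_variables ::
    "(ground \<Rightarrow> 'f::division_ring \<Rightarrow> 'f) \<Rightarrow> 'n::{finite,linorder} set \<Rightarrow> ('n, 'f) qseed \<Rightarrow> 'f set"
  where "quantum_cluster_variables scl mut S =
    {cluster T i | T i. T \<in> mutation_class scl mut S}"

definition quantum_cluster_algebra ::
    "(ground \<Rightarrow> 'f::division_ring \<Rightarrow> 'f) \<Rightarrow> 'n::{finite,linorder} set \<Rightarrow> ('n, 'f) qseed \<Rightarrow> 'f set"
  where "quantum_cluster_algebra scl mut S =
    generated_subalgebra scl (quantum_cluster_variables scl mut S)"


definition graded_quantum_seed ::
    "(ground \<Rightarrow> 'f::division_ring \<Rightarrow> 'f) \<Rightarrow> 'n::{finite,linorder} set \<Rightarrow>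
      ('n, 'f) qseed \<times> 'n zvec \<Rightarrow> bool"
  where "graded_quantum_seed scl mut = (\<lambda>(S, G).
    quantum_seed scl mut S \<and> (\<forall>i\<in>mut. (\<Sum>j\<in>UNIV. exmat S $ i $ j * G $ j) = 0))"

definition monomial_degree :: "'n::finite zvec \<Rightarrow> 'n zvec \<Rightarrow> int"
  where "monomial_degree a G = (\<Sum>i\<in>UNIV. a $ i * G $ i)"

(* When B is skew-symmetric and the k-th row of B annihilates G, b_plus gives the same
   degree as b_minus; see monomial_degree_b_plus. *)
definition mutate_grading :: "'n zmat \<Rightarrow> 'n::finite \<Rightarrow> 'n zvec \<Rightarrow> 'n zvec"
  where "mutate_grading B k G =
    (\<chi> i. if i = k then monomial_degree (b_minus B k) G else G $ i)"

lemma monomial_degree_b_plus: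
  fixes B :: "'n::finite zmat"
  assumes skew: "transpose B = - B" and ann: "(\<Sum>j\<in>UNIV. B $ k $ j * G $ j) = 0"
  shows "monomial_degree (b_plus B k) G = monomial_degree (b_minus B k) G"
proof -
  have swap: "B $ i $ k = - B $ k $ i" for i
  proof -
    have "transpose B $ k $ i = - B $ k $ i"
      by (simp add: skew)
    then show ?thesis by (simp add: transpose_def)
  qed
  have entry: "(\<Sum>i | P i. axis i (B $ i $ k)) $ j = (if P j then B $ j $ k else 0)" for P j
  proof -
    have "(\<Sum>i | P i. axis i (B $ i $ k)) $ j = (\<Sum>i | P i. if i = j then B $ i $ k else 0)"
      unfolding sum_component by (rule sum.cong) (auto simp: axis_def)
    then show ?thesis by simp
  qed
  have "b_plus B k $ j = b_minus B k $ j - B $ k $ j" for j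
    using swap[of j]
    by (simp add: b_plus_def b_minus_def entry del: sum_component)
  then have "monomial_degree (b_plus B k) G =
      monomial_degree (b_minus B k) G - (\<Sum>j\<in>UNIV. B $ k $ j * G $ j)"
    by (simp add: monomial_degree_def left_diff_distrib sum_subtractf)
  with ann show ?thesis by simp
qed

definition mutate_graded ::
    "(ground \<Rightarrow> 'f::division_ring \<Rightarrow> 'f) \<Rightarrow> 'n::{finite,linorder} set \<Rightarrow> 'n \<Rightarrow>
      ('n, 'f) qseed \<times> 'n zvec \<Rightarrow> ('n, 'f) qseed \<times> 'n zvec"
  where "mutate_graded scl mut k =
    (\<lambda>(S, G). (mutate scl mut k S, mutate_grading (exmat S) k G))"

inductive_set graded_mutation_class ::
    "(ground \<Rightarrow> 'f::division_ring \<Rightarrow> 'f) \<Rightarrow> 'n::{finite,linorder} set \<Rightarrow>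
      ('n, 'f) qseed \<times> 'n zvec \<Rightarrow> (('n, 'f) qseed \<times> 'n zvec) set"
  for scl mut SG where
    initial: "SG \<in> graded_mutation_class scl mut SG"
  | step: "TH \<in> graded_mutation_class scl mut SG \<Longrightarrow> k \<in> mut \<Longrightarrow>
      mutate_graded scl mut k TH \<in> graded_mutation_class scl mut SG"

end

theory Submission
  imports Defs
begin

text \<open>
  The degree is read off from an automorphism. On the quantum torus of the initial seed there is an
  algebra endomorphism multiplying the monomial with exponent \<open>a\<close> by \<open>t\<close> to the power \<open>a \<bullet> G\<close>, where
  \<open>t\<close> is the square root of \<open>q\<close>; it extends to the skew-field of fractions. Since \<open>t\<close> is not a root of
  unity, its eigenspaces for the eigenvalues \<open>t\<^sup>d\<close> are linearly independent, and they are compatible with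
  products and inverses. So every quantum cluster variable is an eigenvector with the propagated degree,
  and the algebra generated by eigenvectors is graded by the eigenspaces; no Laurent phenomenon is needed.
  The degree of a cluster variable is well defined because cluster variables are nonzero,
  which follows from quasi-commutation and compatibility of the mutated matrices.
\<close>

section \<open>Powers of the square root of q in the ground field\<close>

lemma qhalf_nonzero: "qhalf \<noteq> 0"
  by (simp add: qhalf_def Zero_fract_def eq_fract)

text \<open>Positive powers of the indeterminate are monomials of positive degree, hence different
  from 1. This separates the eigenvalues of different degrees and the commutation factors with
  different exponents.\<close>

lemma power_int_qhalf_eq_iff: "qhalf powi m = qhalf powi n \<longleftrightarrow> m = n"
proof -
  have power: "qhalf ^ j = Fract (monom 1 j) 1" for j
    by (induction j) (simp_all add: qhalf_def One_fract_def monom_Suc)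
  have pos: "qhalf powi k \<noteq> 1" if k: "k > 0" for k
  proof -
    obtain j where j: "k = int j" "j > 0"
      using zero_less_imp_eq_int[OF k] by blast
    have "(monom 1 j :: rat poly) \<noteq> 1"
      using j(2) by (metis degree_1 degree_monom_eq less_irrefl one_neq_zero)
    then show ?thesis
      by (simp add: j power One_fract_def eq_fract)
  qed
  have less: "qhalf powi a \<noteq> qhalf powi b" if "a < b" for a b
    using pos[of "b - a"] that qhalf_nonzero by (auto simp: power_int_diff)
  show ?thesis
    using less[of m n] less[of n m] by (metis linorder_less_linear)
qed

lemma qhalf_powi_nonzero: "qhalf powi n \<noteq> 0"
  using qhalf_nonzero power_int_not_zero by blast

lemma qpow_eq_iff: "qpow m = qpow n \<longleftrightarrow> m = n"
  by (simp add: qpow_def power_int_qhalf_eq_iff)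

lemma qpow_nonzero: "qpow n \<noteq> 0"
  unfolding qpow_def by (rule qhalf_powi_nonzero)

lemma qpow_add: "qpow (m + n) = qpow m * qpow n"
  by (simp add: qpow_def distrib_left power_int_add qhalf_nonzero)

lemma qpow_minus: "qpow (- n) = inverse (qpow n)"
  by (simp add: qpow_def power_int_minus)

subsection \<open>Extending homomorphisms to fractions\<close>

text \<open>The extension must send \<open>x * inverse y\<close> to
  \<open>f x * inverse (f y)\<close>. Two fractions can be brought to a common denominator inside
  \<open>V\<close>, so this value is independent of the representation; \<open>f_nonzero\<close>
  keeps the images of denominators invertible.\<close>

lemma ring_hom_extends_to_fractions:
  fixes V :: "'f::division_ring set" and f :: "'f \<Rightarrow> 'f"
  assumes add_closed: "\<And>x y. x \<in> V \<Longrightarrow> y \<in> V \<Longrightarrow> x + y \<in> V"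
    and mult_closed: "\<And>x y. x \<in> V \<Longrightarrow> y \<in> V \<Longrightarrow> x * y \<in> V"
    and f_add: "\<And>x y. x \<in> V \<Longrightarrow> y \<in> V \<Longrightarrow> f (x + y) = f x + f y"
    and f_mult: "\<And>x y. x \<in> V \<Longrightarrow> y \<in> V \<Longrightarrow> f (x * y) = f x * f y"
    and f_nonzero: "\<And>x. x \<in> V \<Longrightarrow> x \<noteq> 0 \<Longrightarrow> f x \<noteq> 0"
    and fractions: "\<And>z. \<exists>x\<in>V. \<exists>y\<in>V. y \<noteq> 0 \<and> z = x * inverse y"
  obtains g where "\<And>x. x \<in> V \<Longrightarrow> g x = f x"
    and "\<And>x y. g (x + y) = g x + g y" and "\<And>x y. g (x * y) = g x * g y"
proof -
  text \<open>The right Ore condition holds because left fractions are also right fractions.\<close>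
  have ore: "\<exists>a\<in>V. \<exists>b\<in>V. b \<noteq> 0 \<and> v * b = y * a" if yv: "y \<in> V" "v \<in> V" "y \<noteq> 0" for y v
  proof -
    obtain a b where ab: "a \<in> V" "b \<in> V" "b \<noteq> 0" "inverse y * v = a * inverse b"
      using fractions by blast
    have "v * b = y * (inverse y * v) * b"
      using that by (simp add: mult.assoc[symmetric])
    also have "\<dots> = y * a"
      using ab by (simp add: mult.assoc)
    finally show ?thesis
      using ab by blast
  qed
  have cancel: "x * inverse y = (x * a) * inverse (y * a)" if "a \<noteq> 0" for x y a :: 'f
    using that by (cases "y = 0") (simp_all add: nonzero_inverse_mult_distrib mult.assoc
        mult.assoc[of a "inverse a", symmetric])
  have f_cancel: "f x * inverse (f y) = f (x * a) * inverse (f (y * a))"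
    if "x \<in> V" "y \<in> V" "a \<in> V" "a \<noteq> 0" for x y a
    using that cancel[of "f a" "f x" "f y"] by (simp add: f_mult f_nonzero)
  have well_defined: "f x * inverse (f y) = f u * inverse (f v)"
    if mem: "x \<in> V" "y \<in> V" "u \<in> V" "v \<in> V" "y \<noteq> 0" "v \<noteq> 0"
      and eq: "x * inverse y = u * inverse v" for x y u v
  proof -
    \<comment> \<open>Over the common denominator \<open>y * a = v * b\<close>, equality of the
      fractions becomes equality of the numerators, which \<open>f\<close> respects.\<close>
    obtain a b where ab: "a \<in> V" "b \<in> V" "b \<noteq> 0" "v * b = y * a"
      using ore[of y v] mem by blast
    then have a: "a \<noteq> 0"
      using that by auto
    have "(x * a) * inverse (y * a) = (u * b) * inverse (y * a)"
      using eq cancel[OF a, of x y] cancel[OF ab(3), of u v] ab(4) by simp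
    then have "x * a = u * b"
      using a that by simp
    then show ?thesis
      using f_cancel[of x y a] f_cancel[of u v b] a ab that by simp
  qed
  obtain num den where nd: "\<And>z. num z \<in> V" "\<And>z. den z \<in> V" "\<And>z. den z \<noteq> 0"
      "\<And>z. z = num z * inverse (den z)"
    using fractions by metis
  define g where "g z = f (num z) * inverse (f (den z))" for z
  have g_eq: "g (x * inverse y) = f x * inverse (f y)" if "x \<in> V" "y \<in> V" "y \<noteq> 0" for x y
    unfolding g_def using well_defined[of "num (x * inverse y)" "den (x * inverse y)" x y] nd that
    by metis
  show thesis
  proof
    fix x assume x: "x \<in> V"
    \<comment> \<open>Some nonzero element of \<open>V\<close> is required to write \<open>x\<close>
      as a fraction. Membership of 1 is not assumed, so the denominator chosen for 0 serves.\<close>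
    define y where "y = den 0"
    have y: "y \<in> V" "y \<noteq> 0" "f y \<noteq> 0"
      using nd f_nonzero by (auto simp: y_def)
    have "g (x * y * inverse y) = f (x * y) * inverse (f y)"
      using g_eq x y mult_closed by blast
    then show "g x = f x"
      using x y by (simp add: f_mult mult.assoc)
  next
    fix z w
    obtain x y u v where z: "x \<in> V" "y \<in> V" "y \<noteq> 0" "z = x * inverse y"
      and w: "u \<in> V" "v \<in> V" "v \<noteq> 0" "w = u * inverse v"
      using nd by metis
    obtain a b where ab: "a \<in> V" "b \<in> V" "b \<noteq> 0" "v * b = y * a"
      using ore[of y v] z w by blast
    then have a: "a \<noteq> 0"
      using w by auto
    have z': "z = x * a * inverse (y * a)" and w': "w = u * b * inverse (y * a)"
      using z(4) w(4) cancel[OF a, of x y] cancel[OF ab(3), of u v] ab(4) by simp_all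
    have sum: "z + w = (x * a + u * b) * inverse (y * a)"
      by (simp only: z' w' distrib_right)
    have mem: "x * a \<in> V" "u * b \<in> V" "x * a + u * b \<in> V" "y * a \<in> V" "y * a \<noteq> 0"
      using z w ab a by (simp_all add: mult_closed add_closed)
    have "g (z + w) = (f (x * a) + f (u * b)) * inverse (f (y * a))"
      using g_eq[OF mem(3-5)] f_add[OF mem(1,2)] by (simp only: sum)
    also have "\<dots> = g z + g w"
      using g_eq[OF mem(1,4,5)] g_eq[OF mem(2,4,5)] by (simp only: z' w' distrib_right)
    finally show "g (z + w) = g z + g w" .
  next
    fix z w
    obtain x y u v where z: "x \<in> V" "y \<in> V" "y \<noteq> 0" "z = x * inverse y"
      and w: "u \<in> V" "v \<in> V" "v \<noteq> 0" "w = u * inverse v"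
      using nd by metis
    \<comment> \<open>In a product the inner left fraction \<open>inverse y * u\<close> has to
      become a right fraction, so the Ore condition is applied to \<open>y\<close> and
      \<open>u\<close>, not to the two denominators.\<close>
    obtain a b where ab: "a \<in> V" "b \<in> V" "b \<noteq> 0" "u * b = y * a"
      using ore[of y u] z w by blast
    \<comment> \<open>Stated for arbitrary elements because it serves twice: for elements of
      \<open>V\<close> and for their images under \<open>f\<close>.\<close>
    have middle: "inverse y' * u' = a' * inverse b'"
      if "u' * b' = y' * a'" "y' \<noteq> 0" "b' \<noteq> 0" for y' u' a' b' :: 'f
    proof -
      have "inverse y' * u' = inverse y' * (u' * b') * inverse b'"
        using that(3) by (simp add: mult.assoc)
      also have "\<dots> = (inverse y' * y') * a' * inverse b'"
        by (simp only: that mult.assoc)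
      also have "\<dots> = a' * inverse b'"
        using that by simp
      finally show ?thesis .
    qed
    have "z * w = x * (inverse y * u) * inverse v"
      by (simp add: z w mult.assoc)
    also have "\<dots> = (x * a) * inverse (v * b)"
      using middle[OF ab(4) z(3) ab(3)] w ab
      by (simp add: nonzero_inverse_mult_distrib mult.assoc)
    finally have "g (z * w) = f (x * a) * inverse (f (v * b))"
      using z w ab by (simp add: g_eq mult_closed)
    also have "\<dots> = f x * (f a * inverse (f b)) * inverse (f v)"
      using z w ab f_nonzero[of v] f_nonzero[of b]
      by (simp add: f_mult nonzero_inverse_mult_distrib mult.assoc)
    also have "\<dots> = f x * (inverse (f y) * f u) * inverse (f v)"
      using middle[of "f u" "f b" "f y" "f a"] z w ab f_mult[of u b] f_mult[of y a] f_nonzero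
      by metis
    also have "\<dots> = g z * g w"
      using z w by (simp add: g_eq mult.assoc)
    finally show "g (z * w) = g z * g w" .
  qed
qed

subsection \<open>Mutation of the matrices and of the grading\<close>

lemma skew_entry:
  fixes B :: "'n::finite zmat"
  assumes "transpose B = - B"
  shows "B $ i $ j = - B $ j $ i"
proof -
  have "transpose B $ j $ i = - B $ j $ i"
    by (simp add: assms)
  then show ?thesis
    by (simp add: transpose_def)
qed

lemma skew_congruence:
  fixes B E :: "'n::finite zmat"
  assumes "transpose B = - B"
  shows "transpose (E ** B ** transpose E) = - (E ** B ** transpose E)"
proof -
  have "E ** (- B) = - (E ** B)" "(- C) ** D = - (C ** D)" for C D :: "'n zmat"
    by (simp_all add: vec_eq_iff matrix_matrix_mult_def sum_negf)
  then show ?thesis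
    by (simp add: matrix_transpose_mul assms flip: matrix_mul_assoc)
qed

lemma axis_sum_entry: "(\<Sum>i | P i. axis i (f i)) $ j = (if P j then f j else (0::int))"
  for f :: "'n::finite \<Rightarrow> int"
proof -
  have "(\<Sum>i | P i. axis i (f i)) $ j = (\<Sum>i | P i. if i = j then f i else 0)"
    unfolding sum_component by (rule sum.cong) (auto simp: axis_def)
  then show ?thesis by simp
qed

text \<open>The positive entries of column \<open>k\<close> enter \<open>b_plus\<close>, the
  negative ones with reversed sign enter \<open>b_minus\<close>. Compatibility with \<open>L\<close>
  thereby controls the difference of the two exponents.\<close>

lemma b_plus_eq:
  assumes "transpose B = - B"
  shows "b_plus B k = b_minus B k + column k B"
  by (simp add: vec_eq_iff b_plus_def b_minus_def axis_sum_entry column_def del: sum_component)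

text \<open>Skew-symmetry makes \<open>B $ k $ k\<close> vanish, so the entry at \<open>k\<close> is
  exactly -1 on both sides. Thus \<open>mutE\<close> records the exponent of one of the two exchange
  monomials.\<close>

lemma mutE_column:
  assumes "transpose B = - B"
  shows "column k (mutE B k) = b_minus B k"
  using skew_entry[OF assms, of k k]
  by (auto simp add: vec_eq_iff b_minus_def axis_sum_entry column_def mutE_def max_def
      axis_def[of k] simp del: sum_component)

lemma mutE_entry_other: "j \<noteq> k \<Longrightarrow> mutE B k $ i $ j = (if i = j then 1 else 0)"
  by (simp add: mutE_def)

lemma mutE_column_k: "mutE B k $ i $ k = (if i = k then - 1 else max 0 (- B $ i $ k))"
  by (simp add: mutE_def)

lemma mutE_row_support: "mutE B k $ i $ r \<noteq> 0 \<Longrightarrow> r = i \<or> r = k"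
  by (auto simp: mutE_def split: if_splits)

text \<open>Off column \<open>k\<close> this is the identity matrix. Column \<open>k\<close> is v -
  e with e the \<open>k\<close>-th unit vector and v vanishing at \<open>k\<close>; v is fixed, so e
  is recovered as v - (v - e).\<close>

lemma mutE_involution: "mutE B k ** mutE B k = mat 1"
proof -
  have "(\<Sum>r\<in>UNIV. mutE B k $ i $ r * mutE B k $ r $ j) = (if i = j then 1 else 0)" for i j
  proof (cases "j = k")
    case False
    then show ?thesis
      by (simp add: mutE_entry_other if_distrib cong: if_cong)
  next
    case True
    have "(\<Sum>r\<in>UNIV. mutE B k $ i $ r * mutE B k $ r $ k) =
        mutE B k $ i $ k * mutE B k $ k $ k + (\<Sum>r\<in>UNIV - {k}. mutE B k $ i $ r * mutE B k $ r $ k)"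
      by (simp add: sum.remove)
    also have "(\<Sum>r\<in>UNIV - {k}. mutE B k $ i $ r * mutE B k $ r $ k) =
        (\<Sum>r\<in>UNIV - {k}. if r = i then mutE B k $ r $ k else 0)"
      by (rule sum.cong) (auto simp: mutE_entry_other)
    finally show ?thesis
      using True by (simp add: mutE_column_k)
  qed
  then show ?thesis
    by (simp add: vec_eq_iff matrix_matrix_mult_def mat_def)
qed

text \<open>Row \<open>i\<close> of \<open>mutE B k\<close> is supported on the mutable indices
  \<open>i\<close> and \<open>k\<close>. Hence identities known only in mutable rows survive
  multiplication by \<open>mutE\<close> from the left.\<close>

lemma mutE_mult_mutable_row:
  fixes C :: "'n::finite zmat"
  assumes "k \<in> mut" "i \<in> mut" and "\<And>r. r \<in> mut \<Longrightarrow> C $ r = D $ r"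
  shows "(mutE B k ** C) $ i = (mutE B k ** D) $ i"
proof -
  have "mutE B k $ i $ r * C $ r $ j = mutE B k $ i $ r * D $ r $ j" for r j
    using mutE_row_support[of B k i r] assms by (cases "mutE B k $ i $ r = 0") auto
  then show ?thesis
    unfolding vec_eq_iff matrix_matrix_mult_def by (auto intro: sum.cong)
qed

lemma compatible_iff:
  "compatible mut B L \<longleftrightarrow> (\<exists>d>0. \<forall>i\<in>mut. (transpose B ** L) $ i = (mat d :: 'n::finite zmat) $ i)"
  by (simp add: compatible_def vec_eq_iff matrix_matrix_mult_def transpose_def mat_def)

lemma mat_matrix_mult_row:
  fixes A C :: "'n::finite zmat"
  assumes "A $ r = mat d $ r"
  shows "(A ** C) $ r = d *s (C $ r)"
  using assms
  by (simp add: vec_eq_iff matrix_matrix_mult_def mat_def if_distrib[where f = "\<lambda>x. x * _"] cong: if_cong)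

lemma matrix_mult_smult: "A ** (\<chi> i. d *s C $ i) = (\<chi> i. d *s (A ** C) $ i)"
  for A C :: "'n::finite zmat"
  by (simp add: vec_eq_iff matrix_matrix_mult_def sum_distrib_left mult.left_commute)

text \<open>With E the mutation matrix, E^2 = 1 reduces the mutated product to E (B^T L) E. In
  mutable rows B^T L is d times the identity, which leaves d E E = d. Resetting the entries with
  both indices frozen changes no mutable column of the exchange matrix.\<close>

lemma compatible_mutate:
  fixes S :: "('n::{finite,linorder}, 'f::division_ring) qseed"
  assumes "compatible mut (exmat S) (commat S)" "k \<in> mut"
  shows "compatible mut (exmat (mutate scl mut k S)) (commat (mutate scl mut k S))"
proof -
  define B L E where "B = exmat S" and "L = commat S" and "E = mutE B k"
  obtain d where d: "d > 0" "\<And>i. i \<in> mut \<Longrightarrow> (transpose B ** L) $ i = (mat d :: 'n zmat) $ i"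
    using assms by (auto simp: compatible_iff B_def L_def)
  have EE: "E ** E = mat 1" "transpose E ** transpose E = mat 1"
    by (simp_all add: E_def mutE_involution flip: matrix_transpose_mul)
  have row: "transpose (exmat (mutate scl mut k S)) $ i = transpose (E ** B ** transpose E) $ i"
    if "i \<in> mut" for i
    using that by (simp add: vec_eq_iff mutate_def Let_def B_def E_def transpose_def)
  have "(transpose (exmat (mutate scl mut k S)) ** commat (mutate scl mut k S)) $ i = mat d $ i"
    if i: "i \<in> mut" for i
  proof -
    have "(transpose (exmat (mutate scl mut k S)) ** commat (mutate scl mut k S)) $ i =
        (transpose (E ** B ** transpose E) ** (transpose E ** L ** E)) $ i"
      using row[OF i] by (simp add: vec_eq_iff matrix_matrix_mult_def mutate_def Let_def B_def L_def E_def)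
    also have "transpose (E ** B ** transpose E) ** (transpose E ** L ** E) =
        E ** (transpose B ** (transpose E ** transpose E) ** L ** E)"
      by (simp add: matrix_transpose_mul matrix_mul_assoc)
    also have "\<dots> $ i = (E ** (\<chi> r. d *s E $ r)) $ i"
      unfolding E_def
    proof (rule mutE_mult_mutable_row[OF assms(2) i])
      fix r assume "r \<in> mut"
      then show "(transpose B ** (transpose (mutE B k) ** transpose (mutE B k)) ** L ** mutE B k) $ r =
          (\<chi> r. d *s mutE B k $ r) $ r"
        using mat_matrix_mult_row[OF d(2)] EE by (simp add: E_def)
    qed
    also have "\<dots> = mat d $ i"
      using EE by (simp add: matrix_mult_smult vec_eq_iff mat_def)
    finally show ?thesis .
  qed
  with d(1) show ?thesis
    by (auto simp: compatible_iff)
qed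

text \<open>Degrees are dual to exponents: the new degrees pair the columns of
  \<open>mutE B k\<close> with \<open>G\<close>. In this form the grading can be multiplied with the
  mutated exchange matrix.\<close>

lemma mutate_grading_eq:
  assumes "transpose B = - B"
  shows "mutate_grading B k G = transpose (mutE B k) *v G"
proof -
  have "(\<Sum>i\<in>UNIV. mutE B k $ i $ k * G $ i) = monomial_degree (b_minus B k) G"
    by (simp add: monomial_degree_def column_def flip: mutE_column[OF assms])
  then show ?thesis
    by (auto simp: vec_eq_iff mutate_grading_def matrix_vector_mult_def transpose_def mutE_entry_other
        if_distrib[where f = "\<lambda>x. x * _"] cong: if_cong)
qed

text \<open>By E^2 = 1 the product is E (B G), and a mutable row of E meets B G only at mutable
  indices, where it vanishes.\<close>

lemma exmat_mutate_annihilates: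
  fixes S :: "('n::{finite,linorder}, 'f::division_ring) qseed"
  assumes "transpose (exmat S) = - exmat S" "k \<in> mut"
    and "\<And>i. i \<in> mut \<Longrightarrow> (exmat S *v G) $ i = 0" and "i \<in> mut"
  shows "(exmat (mutate scl mut k S) *v mutate_grading (exmat S) k G) $ i = 0"
proof -
  define B E where "B = exmat S" and "E = mutE B k"
  have EE: "transpose E ** transpose E = mat 1"
    by (simp add: E_def mutE_involution flip: matrix_transpose_mul)
  have "(exmat (mutate scl mut k S) *v mutate_grading B k G) $ i =
      ((E ** B ** transpose E) *v (transpose E *v G)) $ i"
    using assms(1,4)
    by (simp add: mutate_grading_eq B_def E_def mutate_def Let_def matrix_vector_mult_def[of "vec_lambda _"]
        matrix_vector_mult_def[of "_ ** _"])
  also have "(E ** B ** transpose E) *v (transpose E *v G) = E *v (B *v G)"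
    by (simp only: matrix_vector_mul_assoc EE matrix_mul_rid flip: matrix_mul_assoc)
  also have "\<dots> $ i = 0"
  proof -
    have "E $ i $ r * (B *v G) $ r = 0" for r
      using mutE_row_support[of B k i r] assms by (auto simp: E_def B_def)
    then show ?thesis
      unfolding matrix_vector_mult_def[of E] vec_lambda_beta by (intro sum.neutral) blast
  qed
  finally show ?thesis
    by (simp add: B_def)
qed

subsection \<open>Quasi-commutation and the quantum torus\<close>

lemma ordered_monomial_zero: "ordered_monomial X 0 = 1"
proof -
  have "prod_list (map (\<lambda>i. X i powi ((0 :: 'b::{finite,linorder} zvec) $ i)) xs) = 1" for X :: "'b \<Rightarrow> 'a" and xs
    by (induction xs) simp_all
  then show ?thesis
    by (simp add: ordered_monomial_def)
qed

lemma ordered_monomial_axis: "ordered_monomial X (axis i n) = X i powi n"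
proof -
  have "prod_list (map (\<lambda>j. X j powi (axis i n $ j)) xs) = (if i \<in> set xs then X i powi n else 1)"
    if "distinct xs" for xs
    using that by (induction xs) (auto simp: axis_def)
  then show ?thesis
    by (simp add: ordered_monomial_def)
qed

lemma ordered_monomial_nonzero: "(\<And>i. X i \<noteq> 0) \<Longrightarrow> ordered_monomial X a \<noteq> 0"
  by (auto simp: ordered_monomial_def prod_list_zero_iff)

context skew_field_algebra
begin

lemma scl_eq_mult: "scl c x = scl c 1 * x"
  by (simp add: mult_scale_left)

text \<open>Recording the integer exponent instead of the scalar makes it additive in products and
  linear in exponent vectors.\<close>

definition quasi_commute :: "'f \<Rightarrow> 'f \<Rightarrow> int \<Rightarrow> bool"
  where "quasi_commute x y n \<longleftrightarrow> x * y = scl (qpow n) (y * x)"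

lemma quasi_commute_one: "quasi_commute x 1 0"
  by (simp add: quasi_commute_def qpow_def)

lemma quasi_commute_mult:
  assumes "quasi_commute x y m" "quasi_commute x z n"
  shows "quasi_commute x (y * z) (m + n)"
proof -
  have "x * (y * z) = scl (qpow m) (y * (x * z))"
    using assms(1) by (simp add: quasi_commute_def mult_scale_left flip: mult.assoc)
  also have "\<dots> = scl (qpow (m + n)) (y * z * x)"
    using assms(2) by (simp add: quasi_commute_def mult_scale_right mult.assoc qpow_add)
  finally show ?thesis
    by (simp add: quasi_commute_def)
qed

lemma quasi_commute_sym: "quasi_commute x y n \<Longrightarrow> quasi_commute y x (- n)"
  by (simp add: quasi_commute_def qpow_minus qpow_nonzero)

lemma quasi_commute_scl: "quasi_commute x y n \<Longrightarrow> quasi_commute x (scl c y) n"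
  by (simp add: quasi_commute_def mult_scale_left mult_scale_right mult.commute)

lemma quasi_commute_add: "quasi_commute x y n \<Longrightarrow> quasi_commute x z n \<Longrightarrow> quasi_commute x (y + z) n"
  by (simp add: quasi_commute_def distrib_left distrib_right scale_right_distrib)

lemma quasi_commute_inverse:
  assumes "quasi_commute x y n" "y \<noteq> 0"
  shows "quasi_commute x (inverse y) (- n)"
proof -
  have "inverse y * x = inverse y * (x * y) * inverse y"
    using assms(2) by (simp add: mult.assoc)
  also have "\<dots> = scl (qpow n) (inverse y * y * x * inverse y)"
    using assms(1) by (simp add: quasi_commute_def mult_scale_left mult_scale_right mult.assoc)
  finally show ?thesis
    using assms(2) by (simp add: quasi_commute_def qpow_minus qpow_nonzero)
qed

lemma quasi_commute_power: "quasi_commute x y n \<Longrightarrow> quasi_commute x (y ^ j) (int j * n)"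
proof (induction j)
  case 0
  show ?case
    by (simp add: quasi_commute_one)
next
  case (Suc j)
  then show ?case
    using quasi_commute_mult[of x y n "y ^ j" "int j * n"] by (simp add: algebra_simps)
qed

lemma quasi_commute_power_int:
  assumes "quasi_commute x y n" "y \<noteq> 0"
  shows "quasi_commute x (y powi k) (k * n)"
proof (cases k rule: int_cases4)
  case (nonneg j)
  then show ?thesis
    using quasi_commute_power[OF assms(1)] by simp
next
  case (neg j)
  then show ?thesis
    using quasi_commute_inverse[OF quasi_commute_power[OF assms(1), of j]] assms(2)
    by (simp add: power_int_minus)
qed

lemma quasi_commute_prod_list:
  assumes "\<And>i. i \<in> set xs \<Longrightarrow> quasi_commute x (f i) (n i)"
  shows "quasi_commute x (prod_list (map f xs)) (sum_list (map n xs))"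
  using assms by (induction xs) (simp_all add: quasi_commute_one quasi_commute_mult)

lemma quasi_commute_ordered_monomial:
  assumes "\<And>i. quasi_commute x (X i) (n i)" "\<And>i. X i \<noteq> 0"
  shows "quasi_commute x (ordered_monomial X a) (\<Sum>i\<in>UNIV. a $ i * n i)"
  using quasi_commute_prod_list[of "sorted_list_of_set UNIV" x "\<lambda>i. X i powi (a $ i)" "\<lambda>i. a $ i * n i"]
    quasi_commute_power_int assms
  by (simp add: ordered_monomial_def sum_list_distinct_conv_sum_set)

text \<open>Each \<open>g i\<close> is moved left past the later factors of the first product, at
  the cost of a power of q; the existential scalar collects these powers.\<close>

lemma prod_list_map_mult_proportional:
  assumes "\<And>i j. \<exists>n. quasi_commute (f i) (g j) n"
  shows "\<exists>c. prod_list (map f xs) * prod_list (map g xs) = scl c (prod_list (map (\<lambda>i. f i * g i) xs))"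
proof (induction xs)
  case Nil
  show ?case
    by (rule exI[of _ 1]) simp
next
  case (Cons i xs)
  let ?F = "prod_list (map f xs)" and ?G = "prod_list (map g xs)"
  obtain c where c: "?F * ?G = scl c (prod_list (map (\<lambda>i. f i * g i) xs))"
    using Cons by blast
  have "\<exists>n. \<forall>j. quasi_commute (f j) (g i) (n j)"
    by (rule choice) (use assms in blast)
  then obtain n where "\<And>j. quasi_commute (f j) (g i) (n j)"
    by blast
  then have "quasi_commute (g i) (f j) (- n j)" for j
    by (simp add: quasi_commute_sym)
  then have "quasi_commute (g i) ?F (\<Sum>j\<leftarrow>xs. - n j)"
    by (intro quasi_commute_prod_list)
  then obtain m where "quasi_commute (g i) ?F m"
    by blast
  then have m: "?F * g i = scl (qpow (- m)) (g i * ?F)"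
    using quasi_commute_sym by (simp add: quasi_commute_def)
  have "(f i * ?F) * (g i * ?G) = f i * (?F * g i) * ?G"
    by (simp only: mult.assoc)
  also have "\<dots> = scl (qpow (- m)) (f i * g i * (?F * ?G))"
    by (simp add: m mult_scale_left mult_scale_right mult.assoc)
  also have "\<dots> = scl (qpow (- m) * c) (f i * g i * prod_list (map (\<lambda>i. f i * g i) xs))"
    by (simp add: c mult_scale_right)
  finally show ?case
    by auto
qed

lemma ordered_monomial_mult:
  assumes "\<And>i j. quasi_commute (X i) (X j) (L $ i $ j)" "\<And>i. X i \<noteq> 0"
  shows "\<exists>c. ordered_monomial X a * ordered_monomial X b = scl c (ordered_monomial X (a + b))"
proof -
  have "\<exists>n. quasi_commute (X i powi (a $ i)) (X j powi (b $ j)) n" for i j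
    using assms quasi_commute_power_int quasi_commute_sym by meson
  from prod_list_map_mult_proportional[OF this, where xs = "sorted_list_of_set UNIV"] show ?thesis
    by (simp add: ordered_monomial_def power_int_add assms(2))
qed

text \<open>Monomials multiply by adding exponents up to a scalar, and the degree is additive in the
  exponent. So scaling each monomial by t to its degree is multiplicative on the torus, and it
  extends to fractions because the opposite scaling inverts it.\<close>

lemma eigenvalue_endomorphism_exists:
  assumes torus: "quantum_torus_fractions scl X L"
  obtains g where "\<And>x y. g (x + y) = g x + g y" and "\<And>x y. g (x * y) = g x * g y"
    and "\<And>c x. g (scl c x) = scl c (g x)"
    and "\<And>i. g (X i) = scl (qhalf powi (G $ i)) (X i)"
proof -
  let ?m = "ordered_monomial X"
  \<comment> \<open>The linear span of the monomials stands in for the torus: a linear map on it is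
    determined by its values on the basis of monomials.\<close>
  define V where "V = span (range ?m)"
  have X: "X i \<noteq> 0" "quasi_commute (X i) (X j) (L $ i $ j)" for i j
    using torus unfolding quantum_torus_fractions_def quasi_commute_def by blast+
  have inj: "inj ?m" and indep: "independent (range ?m)"
    using torus unfolding quantum_torus_fractions_def by blast+
  have mono_mult: "\<exists>c. ?m a * ?m b = scl c (?m (a + b))" for a b
    using ordered_monomial_mult X by blast
  have mono_mem: "?m a \<in> V" for a
    by (simp add: V_def span_base)
  have subspace: "subspace V"
    by (simp add: V_def)
  have induct: "P x" if "x \<in> V" "\<And>c a y. P y \<Longrightarrow> P (scl c (?m a) + y)" "P 0" for P x
    using that(1) unfolding V_def
  proof (induction rule: span_induct_alt)
    case (step c x y)
    then show ?case
      using that(2) by blast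
  qed (rule that(3))
  have mono_mult_mem: "?m a * y \<in> V" if "y \<in> V" for a y
    using that
  proof (rule induct)
    fix c b y assume "?m a * y \<in> V"
    moreover obtain e where "?m a * ?m b = scl e (?m (a + b))"
      using mono_mult by blast
    ultimately show "?m a * (scl c (?m b) + y) \<in> V"
      using subspace mono_mem
      by (simp add: distrib_left mult_scale_right subspace_add subspace_scale)
  qed (use subspace in \<open>simp add: subspace_0\<close>)
  have V_mult: "x * y \<in> V" if "x \<in> V" "y \<in> V" for x y
    using that(1)
  proof (rule induct)
    fix c a x assume "x * y \<in> V"
    then show "(scl c (?m a) + x) * y \<in> V"
      using subspace mono_mult_mem[OF that(2)]
      by (simp add: distrib_right mult_scale_left subspace_add subspace_scale)
  qed (use subspace in \<open>simp add: subspace_0\<close>)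
  have one: "1 \<in> V"
    using mono_mem[of 0] by (simp add: ordered_monomial_zero)
  have "is_subalgebra scl V"
    using subspace V_mult one by (simp add: is_subalgebra_def)
  moreover have "X i \<in> V" "inverse (X i) \<in> V" for i
    using mono_mem[of "axis i 1"] mono_mem[of "axis i (- 1)"]
    by (simp_all add: ordered_monomial_axis power_int_minus)
  \<comment> \<open>\<open>V\<close> is a subalgebra containing the generators and their inverses,
    so every element is a fraction over \<open>V\<close>.\<close>
  ultimately have "torus_part scl X \<subseteq> V"
    unfolding torus_part_def generated_subalgebra_def by (intro hull_minimal) auto
  then have fractions: "\<exists>x\<in>V. \<exists>y\<in>V. y \<noteq> 0 \<and> z = x * inverse y" for z
    using torus unfolding quantum_torus_fractions_def by blast

  interpret pair: vector_space_pair scl scl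
    by unfold_locales
  \<comment> \<open>The case \<open>s = 1\<close> is the wanted map and \<open>s = - 1\<close> its
    inverse. Injectivity of \<open>?m\<close> lets \<open>inv ?m\<close> recover the exponent of a
    monomial.\<close>
  define twist where "twist = (\<lambda>s::int. pair.construct (range ?m)
      (\<lambda>b. scl (qhalf powi (s * monomial_degree (inv ?m b) G)) b))"
  have linear: "Vector_Spaces.linear scl scl (twist s)" for s
    unfolding twist_def by (rule pair.linear_construct[OF indep])
  have twist_mono: "twist s (?m a) = scl (qhalf powi (s * monomial_degree a G)) (?m a)" for s a
    using pair.construct_basis[OF indep, of "?m a"] inj by (simp add: twist_def)
  have twist_add: "twist s (x + y) = twist s x + twist s y"
    and twist_scl: "twist s (scl c x) = scl c (twist s x)"
    and twist_zero: "twist s 0 = 0" for s x y c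
    by (rule pair.linear_add[OF linear], rule pair.linear_scale[OF linear], rule pair.linear_0[OF linear])
  have degree_add: "monomial_degree (a + b) G = monomial_degree a G + monomial_degree b G" for a b
    by (simp add: monomial_degree_def distrib_right sum.distrib)
  have twist_mono_mult: "twist 1 (?m a * y) = twist 1 (?m a) * twist 1 y" if "y \<in> V" for a y
    using that
  proof (rule induct)
    fix c b y assume IH: "twist 1 (?m a * y) = twist 1 (?m a) * twist 1 y"
    obtain e where e: "?m a * ?m b = scl e (?m (a + b))"
      using mono_mult by blast
    then have "twist 1 (?m a * ?m b) = twist 1 (?m a) * twist 1 (?m b)"
      by (simp add: twist_scl twist_mono mult_scale_left mult_scale_right degree_add
          power_int_add qhalf_nonzero ac_simps)
    with IH show "twist 1 (?m a * (scl c (?m b) + y)) = twist 1 (?m a) * twist 1 (scl c (?m b) + y)"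
      by (simp add: distrib_left mult_scale_right twist_add twist_scl)
  qed (simp add: twist_zero)
  have twist_mult: "twist 1 (x * y) = twist 1 x * twist 1 y" if "x \<in> V" "y \<in> V" for x y
    using that(1)
  proof (rule induct)
    fix c a x assume "twist 1 (x * y) = twist 1 x * twist 1 y"
    then show "twist 1 ((scl c (?m a) + x) * y) = twist 1 (scl c (?m a) + x) * twist 1 y"
      using twist_mono_mult[OF that(2)]
      by (simp add: distrib_right mult_scale_left twist_add twist_scl)
  qed (simp add: twist_zero)
  \<comment> \<open>A left inverse gives injectivity on \<open>V\<close>, which the extension to
    fractions requires.\<close>
  have "twist (- 1) (twist 1 x) = x" if "x \<in> V" for x
    using that
  proof (rule induct)
    fix c a x assume "twist (- 1) (twist 1 x) = x"
    then show "twist (- 1) (twist 1 (scl c (?m a) + x)) = scl c (?m a) + x"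
      by (simp add: twist_add twist_scl twist_mono power_int_minus qhalf_nonzero)
  qed (simp add: twist_zero)
  then have twist_nonzero: "twist 1 x \<noteq> 0" if "x \<in> V" "x \<noteq> 0" for x
    using that twist_zero by metis
  obtain g where g: "\<And>x. x \<in> V \<Longrightarrow> g x = twist 1 x"
      "\<And>x y. g (x + y) = g x + g y" "\<And>x y. g (x * y) = g x * g y"
  proof (rule ring_hom_extends_to_fractions[of V "twist 1", OF subspace_add[OF subspace] V_mult
        twist_add twist_mult twist_nonzero fractions])
    fix g
    assume "\<And>x. x \<in> V \<Longrightarrow> g x = twist 1 x"
      "\<And>x y. g (x + y) = g x + g y" "\<And>x y. g (x * y) = g x * g y"
    then show thesis
      by (rule that)
  qed
  show thesis
  proof
    \<comment> \<open>The extension is so far only additive and multiplicative. Since scaling by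
      \<open>c\<close> is multiplication by \<open>scl c 1\<close>, it is enough that
      \<open>g\<close> fixes these scalars.\<close>
    have "twist 1 1 = 1"
      using twist_mono[of 1 0] by (simp add: ordered_monomial_zero monomial_degree_def)
    then have "g (scl c 1) = scl c 1" for c
      using g(1) subspace_scale[OF subspace one] by (simp add: twist_scl)
    then show "g (scl c x) = scl c (g x)" for c x
      using g(3) scl_eq_mult by metis
    have "monomial_degree (axis i 1) G = G $ i" for i
      by (simp add: monomial_degree_def axis_def if_distrib[where f = "\<lambda>x. x * _"] cong: if_cong)
    then show "g (X i) = scl (qhalf powi (G $ i)) (X i)" for i
      using g(1)[OF mono_mem, of "axis i 1"] twist_mono[of 1 "axis i 1"]
      by (simp add: ordered_monomial_axis)
  qed (rule g)+
qed

end

subsection \<open>Eigenspace gradings\<close>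

context skew_field_algebra
begin

definition eigenspace :: "('f \<Rightarrow> 'f) \<Rightarrow> int \<Rightarrow> 'f set"
  where "eigenspace g d = {z. g z = scl (qhalf powi d) z}"

text \<open>Different integers give different eigenvalues because t has infinite order. This makes
  the degree of a nonzero homogeneous element well defined.\<close>

lemma eigenspace_unique: "x \<in> eigenspace g d \<Longrightarrow> x \<in> eigenspace g e \<Longrightarrow> x \<noteq> 0 \<Longrightarrow> d = e"
  by (simp add: eigenspace_def power_int_qhalf_eq_iff)

lemma is_subalgebra_generated: "is_subalgebra scl (generated_subalgebra scl W)"
  unfolding generated_subalgebra_def
proof (rule hull_in)
  fix T assume T: "Ball T (is_subalgebra scl)"
  then have "subspace (\<Inter>T)"
    by (intro subspace_Inter) (simp add: is_subalgebra_def)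
  with T show "is_subalgebra scl (\<Inter>T)"
    by (simp add: is_subalgebra_def)
qed

lemma generated_subalgebra_superset: "W \<subseteq> generated_subalgebra scl W"
  unfolding generated_subalgebra_def by (rule hull_subset)

end

section \<open>Eigenvectors of an endomorphism: products, inverses and independence\<close>

locale algebra_endomorphism = skew_field_algebra scl
  for scl :: "ground \<Rightarrow> 'f::division_ring \<Rightarrow> 'f" +
  fixes g :: "'f \<Rightarrow> 'f"
  assumes add: "g (x + y) = g x + g y"
    and mult: "g (x * y) = g x * g y"
    and scale: "g (scl c x) = scl c (g x)"
begin

lemma zero: "g 0 = 0"
  using add[of 0 0] by simp

lemma subspace_eigenspace: "subspace (eigenspace g d)"
  by (simp add: subspace_def eigenspace_def zero add scale scale_right_distrib mult.commute)

lemma eigenspace_mult: "x \<in> eigenspace g d \<Longrightarrow> y \<in> eigenspace g e \<Longrightarrow> x * y \<in> eigenspace g (d + e)"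
  by (simp add: eigenspace_def mult mult_scale_left mult_scale_right power_int_add qhalf_nonzero mult.commute)

text \<open>The zero map satisfies the locale assumptions, so \<open>g 1 = 1\<close> has to be
  derived: a nonzero eigenvector has nonzero image, which cancels from
  \<open>g x = g x * g 1\<close>.\<close>

lemma eigenspace_one:
  assumes "x \<in> eigenspace g d" "x \<noteq> 0"
  shows "1 \<in> eigenspace g 0"
proof -
  have "g x \<noteq> 0"
    using assms by (simp add: eigenspace_def qhalf_nonzero)
  moreover have "g x = g x * g 1"
    using mult[of x 1] by simp
  ultimately have "g 1 = 1"
    by simp
  then show ?thesis
    by (simp add: eigenspace_def)
qed

lemma eigenspace_inverse:
  assumes "x \<in> eigenspace g d" "x \<noteq> 0"
  shows "inverse x \<in> eigenspace g (- d)"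
proof -
  have "g (inverse x) * g x = 1"
    using eigenspace_one[OF assms] assms(2) by (simp add: eigenspace_def flip: mult)
  then have "scl (qhalf powi d) (g (inverse x) * x) = 1"
    using assms(1) by (simp add: eigenspace_def mult_scale_right)
  then have "g (inverse x) * x = scl (qhalf powi (- d)) 1"
    by (metis power_int_minus qhalf_powi_nonzero scale_left_imp_eq scale_one scale_scale right_inverse)
  then have "g (inverse x) * x * inverse x = scl (qhalf powi (- d)) (inverse x)"
    by (simp add: mult_scale_left)
  then show ?thesis
    using assms(2) by (simp add: eigenspace_def mult.assoc)
qed

lemma eigenspace_power:
  assumes "x \<in> eigenspace g d" "x \<noteq> 0"
  shows "x ^ n \<in> eigenspace g (int n * d)"
proof (induction n)
  case 0
  show ?case
    using eigenspace_one[OF assms] by simp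
next
  case (Suc n)
  then show ?case
    using eigenspace_mult[OF assms(1), of "x ^ n" "int n * d"] by (simp add: algebra_simps)
qed

lemma eigenspace_power_int:
  assumes "x \<in> eigenspace g d" "x \<noteq> 0"
  shows "x powi n \<in> eigenspace g (n * d)"
proof (cases n rule: int_cases4)
  case (nonneg j)
  then show ?thesis
    using eigenspace_power[OF assms] by simp
next
  case (neg j)
  then show ?thesis
    using eigenspace_inverse[OF eigenspace_power[OF assms, of j]] assms(2)
    by (simp add: power_int_minus)
qed

lemma eigenspace_ordered_monomial:
  assumes "\<And>i. X i \<in> eigenspace g (H $ i)" "\<And>i. X i \<noteq> 0"
  shows "ordered_monomial X a \<in> eigenspace g (monomial_degree a H)"
proof -
  have "prod_list (map (\<lambda>i. X i powi (a $ i)) xs) \<in> eigenspace g (\<Sum>i\<leftarrow>xs. a $ i * H $ i)" for xs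
    by (induction xs)
      (use assms eigenspace_one eigenspace_power_int eigenspace_mult in auto)
  from this[of "sorted_list_of_set UNIV"] show ?thesis
    by (simp add: ordered_monomial_def monomial_degree_def sum_list_distinct_conv_sum_set)
qed

text \<open>The classical argument for distinct eigenvalues: apply \<open>g\<close> to a vanishing
  sum and subtract a multiple of the sum, which removes one term.\<close>

lemma eigenspaces_independent:
  assumes "finite D" "\<And>d. d \<in> D \<Longrightarrow> f d \<in> eigenspace g d" "(\<Sum>d\<in>D. f d) = 0" "d \<in> D"
  shows "f d = 0"
  using assms
proof (induction D arbitrary: f d rule: finite_induct)
  case empty
  then show ?case by simp
next
  case (insert e D)
  have f: "g (f d) = scl (qhalf powi d) (f d)" if "d \<in> insert e D" for d
    using insert.prems(1)[OF that] by (simp add: eigenspace_def)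
  have g_sum: "g (sum h A) = (\<Sum>d\<in>A. g (h d))" for h and A :: "int set"
    by (induction A rule: infinite_finite_induct) (simp_all add: zero add)
  have e: "f e = - (\<Sum>d\<in>D. f d)"
    using insert by (simp add: eq_neg_iff_add_eq_0)
  have "(\<Sum>d\<in>insert e D. g (f d)) = 0"
    using insert.prems(2) zero g_sum[of f "insert e D"] by simp
  then have "scl (qhalf powi e) (f e) + (\<Sum>d\<in>D. scl (qhalf powi d) (f d)) = 0"
    using insert.hyps f by simp
  \<comment> \<open>The term at \<open>e\<close> is eliminated by
    \<open>f e = - (\<Sum>d\<in>D. f d)\<close>. The induction hypothesis then applies to the
    rescaled family, whose coefficients are nonzero because \<open>e\<close> is not in
    \<open>D\<close>.\<close>
  then have "(\<Sum>d\<in>D. scl (qhalf powi d - qhalf powi e) (f d)) = 0"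
    by (simp add: e scale_left_diff_distrib sum_subtractf scale_sum_right)
  moreover have "scl (qhalf powi d - qhalf powi e) (f d) \<in> eigenspace g d" if "d \<in> D" for d
    using insert.prems(1) that subspace_eigenspace subspace_scale by blast
  ultimately have "scl (qhalf powi d - qhalf powi e) (f d) = 0" if "d \<in> D" for d
    using insert.IH[of "\<lambda>d. scl (qhalf powi d - qhalf powi e) (f d)"] that by blast
  moreover have "qhalf powi d - qhalf powi e \<noteq> 0" if "d \<in> D" for d
    using insert.hyps that by (auto simp: power_int_qhalf_eq_iff)
  ultimately have "f d = 0" if "d \<in> D" for d
    using that by simp
  then show ?case
    using insert.prems(3) e by auto
qed

text \<open>Over the union of the two supports the differences of components sum to zero, so
  independence kills each of them.\<close>

lemma eigenspace_decomposition_unique: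
  assumes "\<And>d. f d \<in> eigenspace g d" "finite {d. f d \<noteq> 0}"
    and "\<And>d. h d \<in> eigenspace g d" "finite {d. h d \<noteq> 0}"
    and "(\<Sum>d | f d \<noteq> 0. f d) = (\<Sum>d | h d \<noteq> 0. h d)"
  shows "f = h"
proof
  fix d
  define D where "D = {d. f d \<noteq> 0} \<union> {d. h d \<noteq> 0}"
  have "(\<Sum>d\<in>D. f d) = (\<Sum>d | f d \<noteq> 0. f d)" "(\<Sum>d\<in>D. h d) = (\<Sum>d | h d \<noteq> 0. h d)"
    using assms(2,4) by (auto simp: D_def intro!: sum.mono_neutral_right)
  then have "(\<Sum>d\<in>D. f d - h d) = 0"
    using assms(5) by (simp add: sum_subtractf)
  moreover have "f d - h d \<in> eigenspace g d" for d
    using assms(1,3) subspace_eigenspace subspace_diff by blast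
  moreover have "finite D"
    using assms(2,4) by (simp add: D_def)
  ultimately have "f d - h d = 0" if "d \<in> D"
    using eigenspaces_independent[of D "\<lambda>d. f d - h d"] that by blast
  then show "f d = h d"
    by (cases "d \<in> D") (auto simp: D_def)
qed

lemma span_Union_decomposition:
  assumes "\<And>d. subspace (gr d)" "x \<in> span (\<Union>d. gr d)"
  shows "\<exists>f. (\<forall>d::int. f d \<in> gr d) \<and> finite {d. f d \<noteq> 0} \<and> x = (\<Sum>d | f d \<noteq> 0. f d)"
  using assms(2)
proof (induction rule: span_induct_alt)
  case base
  show ?case
    by (rule exI[of _ "\<lambda>_. 0"]) (simp add: assms(1) subspace_0)
next
  case (step c y x)
  obtain f where f: "\<And>d. f d \<in> gr d" "finite {d. f d \<noteq> 0}" "x = (\<Sum>d | f d \<noteq> 0. f d)"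
    using step by blast
  obtain e where e: "y \<in> gr e"
    using step by blast
  \<comment> \<open>The new summand joins the component of its own degree. It may cancel that
    component, so the sums are compared over \<open>insert e {d. f d \<noteq> 0}\<close>, which
    contains both supports.\<close>
  define h where "h = f(e := scl c y + f e)"
  have fin: "finite (insert e {d. f d \<noteq> 0})"
    using f(2) by simp
  have sub: "{d. h d \<noteq> 0} \<subseteq> insert e {d. f d \<noteq> 0}"
    by (auto simp: h_def)
  have "(\<Sum>d | h d \<noteq> 0. h d) = (\<Sum>d\<in>insert e {d. f d \<noteq> 0}. h d)"
    using fin sub by (intro sum.mono_neutral_left) auto
  also have "\<dots> = h e + (\<Sum>d\<in>{d. f d \<noteq> 0} - {e}. f d)"
    using f(2) by (simp add: sum.insert_remove h_def)
  also have "\<dots> = scl c y + (\<Sum>d\<in>insert e {d. f d \<noteq> 0}. f d)"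
    using f(2) by (simp add: sum.insert_remove h_def add.assoc)
  also have "(\<Sum>d\<in>insert e {d. f d \<noteq> 0}. f d) = x"
    unfolding f(3) using fin by (intro sum.mono_neutral_right) auto
  finally have "scl c y + x = (\<Sum>d | h d \<noteq> 0. h d)"
    by simp
  moreover have "h d \<in> gr d" for d
    using f(1) e assms(1) by (simp add: h_def subspace_add subspace_scale)
  moreover have "finite {d. h d \<noteq> 0}"
    using fin sub by (rule finite_subset[rotated])
  ultimately show ?case
    by blast
qed

text \<open>The span of the homogeneous elements of the algebra is itself a subalgebra containing
  \<open>W\<close>, hence is everything; this gives existence of decompositions. Uniqueness is
  inherited from the eigenspaces.\<close>

lemma generated_subalgebra_graded_by_eigenspaces:
  assumes W: "\<And>w. w \<in> W \<Longrightarrow> \<exists>d. w \<in> eigenspace g d" and one: "1 \<in> eigenspace g 0"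
  shows "is_Z_grading scl (generated_subalgebra scl W)
    (\<lambda>d. eigenspace g d \<inter> generated_subalgebra scl W)"
proof -
  define A where "A = generated_subalgebra scl W"
  define gr where "gr = (\<lambda>d. eigenspace g d \<inter> A)"
  have A: "subspace A" "1 \<in> A" "\<And>x y. x \<in> A \<Longrightarrow> y \<in> A \<Longrightarrow> x * y \<in> A"
    using is_subalgebra_generated[of W] by (simp_all add: A_def is_subalgebra_def)
  have subspace: "subspace (gr d)" for d
    unfolding gr_def using subspace_inter subspace_eigenspace A(1) by blast
  have gr_mult: "x * y \<in> gr (d + e)" if "x \<in> gr d" "y \<in> gr e" for x y d e
    using that A(3) eigenspace_mult by (auto simp: gr_def)
  define U where "U = span (\<Union>d. gr d)"
  have gr_U: "x \<in> U" if "x \<in> gr d" for x d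
    unfolding U_def using that by (intro span_base) blast
  have U: "subspace U"
    by (simp add: U_def)
  have left: "x * y \<in> U" if "x \<in> gr d" "y \<in> U" for x y d
    using that(2) unfolding U_def
  proof (induction rule: span_induct_alt)
    case (step c z y)
    then obtain e where "z \<in> gr e"
      by blast
    then have "x * z \<in> U"
      using gr_U gr_mult that(1) by blast
    with step show ?case
      using U by (simp add: distrib_left mult_scale_right subspace_add subspace_scale flip: U_def)
  qed (simp add: span_zero)
  have U_mult: "x * y \<in> U" if "x \<in> U" "y \<in> U" for x y
    using that(1) unfolding U_def
  proof (induction rule: span_induct_alt)
    case (step c z x)
    then obtain e where "z \<in> gr e"
      by blast
    then have "z * y \<in> U"
      using left that(2) by blast
    with step show ?case
      using U by (simp add: distrib_right mult_scale_left subspace_add subspace_scale flip: U_def)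
  qed (simp add: span_zero)
  have "is_subalgebra scl U"
    using U U_mult gr_U[of 1 0] one A(2) by (simp add: is_subalgebra_def gr_def)
  moreover have "W \<subseteq> U"
    using W gr_U generated_subalgebra_superset[of W] by (fastforce simp: gr_def A_def)
  ultimately have "A \<subseteq> U"
    unfolding A_def generated_subalgebra_def by (rule hull_minimal[rotated])
  then have "\<exists>f. (\<forall>d. f d \<in> gr d) \<and> finite {d. f d \<noteq> 0} \<and> x = (\<Sum>d | f d \<noteq> 0. f d)" if "x \<in> A" for x
    using span_Union_decomposition[of gr x] subspace that by (auto simp: U_def)
  moreover have "f = h"
    if "(\<forall>d. f d \<in> gr d) \<and> finite {d. f d \<noteq> 0} \<and> x = (\<Sum>d | f d \<noteq> 0. f d)"
      "(\<forall>d. h d \<in> gr d) \<and> finite {d. h d \<noteq> 0} \<and> x = (\<Sum>d | h d \<noteq> 0. h d)" for f h x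
    using eigenspace_decomposition_unique[of f h] that by (auto simp: gr_def)
  ultimately have "\<exists>!f. (\<forall>d. f d \<in> gr d) \<and> finite {d. f d \<noteq> 0} \<and> x = (\<Sum>d | f d \<noteq> 0. f d)"
    if "x \<in> A" for x
    using that by (intro ex_ex1I) blast+
  then have "is_Z_grading scl A gr"
    using subspace gr_mult unfolding is_Z_grading_def by (auto simp: gr_def)
  then show ?thesis
    by (simp add: gr_def A_def)
qed

end

subsection \<open>Homogeneity of quantum cluster variables\<close>

text \<open>The part of the definition of a graded quantum seed that is needed along mutations: the linear
  independence of the monomials and the generation of the skew-field are dropped.\<close>

definition graded_quasi_seed ::
    "(ground \<Rightarrow> 'f::division_ring \<Rightarrow> 'f) \<Rightarrow> 'n::{finite,linorder} set \<Rightarrow>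
      ('n, 'f) qseed \<Rightarrow> 'n zvec \<Rightarrow> bool"
  where "graded_quasi_seed scl mut T H \<longleftrightarrow>
    (\<forall>i. cluster T i \<noteq> 0) \<and>
    (\<forall>i j. skew_field_algebra.quasi_commute scl (cluster T i) (cluster T j) (commat T $ i $ j)) \<and>
    transpose (commat T) = - commat T \<and> transpose (exmat T) = - exmat T \<and>
    compatible mut (exmat T) (commat T) \<and> (\<forall>i\<in>mut. (exmat T *v H) $ i = 0)"

text \<open>Congruence preserves skew-symmetry, and the set of entries reset to 0 is symmetric in
  the two indices.\<close>

lemma transpose_exmat_mutate:
  assumes "transpose (exmat T) = - exmat T"
  shows "transpose (exmat (mutate scl mut k T)) = - exmat (mutate scl mut k T)"
proof -
  define C where "C = mutE (exmat T) k ** exmat T ** transpose (mutE (exmat T) k)"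
  have C: "C $ i $ j = - C $ j $ i" for i j
    unfolding C_def by (rule skew_entry[OF skew_congruence[OF assms]])
  have "exmat (mutate scl mut k T) $ i $ j = - exmat (mutate scl mut k T) $ j $ i" for i j
    using C[of i j] by (auto simp: mutate_def Let_def simp flip: C_def)
  then show ?thesis
    unfolding vec_eq_iff transpose_def vec_lambda_beta vector_uminus_component by blast
qed

lemma transpose_commat_mutate:
  assumes "transpose (commat T) = - commat T"
  shows "transpose (commat (mutate scl mut k T)) = - commat (mutate scl mut k T)"
  using skew_congruence[OF assms, of "transpose (mutE (exmat T) k)"] by (simp add: mutate_def Let_def)

lemma matrix_vector_mul_component_axis: "(A *v axis i 1) $ j = (A :: 'n::finite zmat) $ j $ i"
  by (simp add: matrix_vector_mult_def axis_def if_distrib[where f = "\<lambda>x. _ * x"] cong: if_cong)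

text \<open>Row \<open>j\<close> of the transposed mutation matrix is a unit vector, so only right
  multiplication acts, replacing column \<open>k\<close> by the image of \<open>b_minus\<close>.
  These are the commutation exponents of the old variables with the exchange monomial.\<close>

lemma commat_mutate_entry:
  assumes "transpose (exmat T) = - exmat T" "j \<noteq> k"
  shows "commat (mutate scl mut k T) $ j $ i =
    (if i = k then (commat T *v b_minus (exmat T) k) $ j else commat T $ j $ i)"
proof -
  define E where "E = mutE (exmat T) k"
  have "transpose E $ j = axis j 1"
    using assms(2) by (auto simp: E_def vec_eq_iff transpose_def mutE_entry_other axis_def)
  then have "(transpose E ** (commat T ** E)) $ j $ i = (commat T ** E) $ j $ i"
    by (simp add: matrix_matrix_mult_def[of "transpose E"] axis_def if_distrib[where f = "\<lambda>x. x * _"] cong: if_cong)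
  also have "\<dots> = (commat T *v column i E) $ j"
    by (simp add: matrix_matrix_mult_def matrix_vector_mult_def column_def)
  also have "column i E = (if i = k then b_minus (exmat T) k else axis i 1)"
    using mutE_column[OF assms(1)] by (auto simp: E_def vec_eq_iff column_def mutE_entry_other axis_def)
  also have "(commat T *v (if i = k then b_minus (exmat T) k else axis i 1)) $ j =
      (if i = k then (commat T *v b_minus (exmat T) k) $ j else commat T $ j $ i)"
    by (simp add: matrix_vector_mul_component_axis)
  finally show ?thesis
    by (simp add: mutate_def Let_def E_def matrix_mul_assoc)
qed

context skew_field_algebra
begin

lemma quasi_commute_toric_frame:
  assumes "graded_quasi_seed scl mut T H"
  shows "quasi_commute (cluster T j) (toric_frame scl T a) ((commat T *v a) $ j)"
proof -
  have "quasi_commute (cluster T j) (ordered_monomial (cluster T) a) (\<Sum>i\<in>UNIV. a $ i * commat T $ j $ i)"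
    using assms by (intro quasi_commute_ordered_monomial) (simp_all add: graded_quasi_seed_def)
  then show ?thesis
    unfolding toric_frame_def
    by (intro quasi_commute_scl) (simp add: matrix_vector_mult_def mult.commute)
qed

lemma toric_frame_nonzero:
  "graded_quasi_seed scl mut T H \<Longrightarrow> toric_frame scl T a \<noteq> 0"
  by (simp add: toric_frame_def graded_quasi_seed_def ordered_monomial_nonzero qhalf_powi_nonzero
      del: power_int_eq_0_iff)

text \<open>The two exponent vectors differ by column \<open>k\<close> of the exchange matrix.
  Compatibility evaluates \<open>commat T\<close> on that column, and skew-symmetry of
  \<open>commat T\<close> accounts for the sign.\<close>

lemma compatible_b_plus:
  assumes "graded_quasi_seed scl mut T H" "k \<in> mut"
  obtains d where "d > 0" and "\<And>j. (commat T *v b_plus (exmat T) k) $ j =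
    (commat T *v b_minus (exmat T) k) $ j - (if j = k then d else 0)"
proof -
  obtain d where d: "d > 0"
      "\<And>j. (\<Sum>i\<in>UNIV. exmat T $ i $ k * commat T $ i $ j) = (if k = j then d else 0)"
    using assms by (auto simp: graded_quasi_seed_def compatible_def)
  have skew: "transpose (exmat T) = - exmat T" "transpose (commat T) = - commat T"
    using assms by (simp_all add: graded_quasi_seed_def)
  have "(commat T *v column k (exmat T)) $ j = - (if j = k then d else 0)" for j
  proof -
    have "(commat T *v column k (exmat T)) $ j = (\<Sum>i\<in>UNIV. - (exmat T $ i $ k * commat T $ i $ j))"
      unfolding matrix_vector_mult_def column_def vec_lambda_beta
      by (rule sum.cong) (simp_all add: skew_entry[OF skew(2), of j])
    then show ?thesis
      by (simp add: sum_negf d(2))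
  qed
  with d(1) show thesis
    by (intro that[of d]) (simp_all add: b_plus_eq[OF skew(1)] matrix_vector_right_distrib)
qed

text \<open>The two monomials of the exchange relation have different commutation factors with the
  variable being replaced, so they cannot cancel.\<close>

lemma exchange_nonzero:
  assumes T: "graded_quasi_seed scl mut T H" and k: "k \<in> mut"
  shows "toric_frame scl T (b_plus (exmat T) k) + toric_frame scl T (b_minus (exmat T) k) \<noteq> 0"
    (is "?P + ?M \<noteq> 0")
proof
  assume "?P + ?M = 0"
  then have P: "?P = scl (- 1) ?M"
    by (simp add: eq_neg_iff_add_eq_0)
  let ?x = "cluster T k"
  let ?p = "(commat T *v b_plus (exmat T) k) $ k" and ?m = "(commat T *v b_minus (exmat T) k) $ k"
  obtain d where "d > 0" "?p = ?m - (if k = k then d else 0)"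
    using compatible_b_plus[OF T k] by blast
  then have neq: "?p \<noteq> ?m"
    by simp
  have "quasi_commute ?x ?P ?p"
    by (rule quasi_commute_toric_frame[OF T])
  moreover have "quasi_commute ?x ?P ?m"
    unfolding P by (rule quasi_commute_scl[OF quasi_commute_toric_frame[OF T]])
  ultimately have "?x * ?P = scl (qpow ?p) (?P * ?x)" "?x * ?P = scl (qpow ?m) (?P * ?x)"
    unfolding quasi_commute_def by blast+
  then have "scl (qpow ?p) (?P * ?x) = scl (qpow ?m) (?P * ?x)"
    by metis
  moreover have "?P * ?x \<noteq> 0"
    using T toric_frame_nonzero[OF T] by (simp add: graded_quasi_seed_def)
  ultimately show False
    using neq by (simp add: qpow_eq_iff)
qed

lemma cluster_mutate:
  "cluster (mutate scl mut k T) = (cluster T)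
    (k := toric_frame scl T (b_plus (exmat T) k) + toric_frame scl T (b_minus (exmat T) k))"
  by (simp add: mutate_def Let_def)

text \<open>For \<open>j \<noteq> k\<close> both exchange monomials have the same commutation
  exponent with the variable \<open>j\<close>, namely the mutated entry, so their sum has it too.
  The case with the indices exchanged follows by skew-symmetry.\<close>

lemma graded_quasi_seed_mutate:
  assumes T: "graded_quasi_seed scl mut T H" and k: "k \<in> mut"
  shows "graded_quasi_seed scl mut (mutate scl mut k T) (mutate_grading (exmat T) k H)"
proof -
  define T' where "T' = mutate scl mut k T"
  define x where "x = toric_frame scl T (b_plus (exmat T) k) + toric_frame scl T (b_minus (exmat T) k)"
  have cluster: "cluster T' = (cluster T)(k := x)"
    by (simp add: T'_def x_def cluster_mutate)
  have skew: "transpose (exmat T) = - exmat T" "transpose (commat T) = - commat T"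
    using T by (simp_all add: graded_quasi_seed_def)
  have skew': "commat T' $ i $ j = - commat T' $ j $ i" for i j
    unfolding T'_def by (rule skew_entry[OF transpose_commat_mutate[OF skew(2)]])
  have x: "quasi_commute (cluster T j) x (commat T' $ j $ k)" if "j \<noteq> k" for j
  proof -
    obtain d where "\<And>j. (commat T *v b_plus (exmat T) k) $ j =
        (commat T *v b_minus (exmat T) k) $ j - (if j = k then d else 0)"
      using compatible_b_plus[OF T k] by metis
    with that have "(commat T *v b_plus (exmat T) k) $ j = (commat T *v b_minus (exmat T) k) $ j"
      by simp
    then show ?thesis
      using quasi_commute_toric_frame[OF T, of j "b_plus (exmat T) k"]
        quasi_commute_toric_frame[OF T, of j "b_minus (exmat T) k"] that
      unfolding x_def by (intro quasi_commute_add) (simp_all add: T'_def commat_mutate_entry[OF skew(1)])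
  qed
  have "quasi_commute (cluster T' i) (cluster T' j) (commat T' $ i $ j)" for i j
  proof (cases "i = k")
    case True
    show ?thesis
    proof (cases "j = k")
      case True
      have "commat T' $ k $ k = 0"
        using skew'[of k k] by simp
      then show ?thesis
        using True \<open>i = k\<close> by (simp add: quasi_commute_def qpow_def)
    next
      case False
      then show ?thesis
        using quasi_commute_sym[OF x[of j]] skew'[of i j] True by (simp add: cluster)
    qed
  next
    case False
    show ?thesis
    proof (cases "j = k")
      case True
      then show ?thesis
        using x False by (simp add: cluster)
    next
      case False
      then show ?thesis
        using T \<open>i \<noteq> k\<close>
        by (simp add: cluster_mutate T'_def commat_mutate_entry[OF skew(1)] graded_quasi_seed_def)
    qed
  qed
  moreover have "cluster T' i \<noteq> 0" for i
    using T exchange_nonzero[OF T k] by (simp add: cluster x_def graded_quasi_seed_def)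
  moreover have "(exmat T' *v mutate_grading (exmat T) k H) $ i = 0" if "i \<in> mut" for i
    unfolding T'_def using skew(1) k _ that
    by (rule exmat_mutate_annihilates) (use T in \<open>simp add: graded_quasi_seed_def\<close>)
  moreover have "compatible mut (exmat T') (commat T')"
    unfolding T'_def using T k by (intro compatible_mutate) (simp_all add: graded_quasi_seed_def)
  ultimately show ?thesis
    using transpose_exmat_mutate[OF skew(1)] transpose_commat_mutate[OF skew(2)]
    by (simp add: graded_quasi_seed_def flip: T'_def) (simp add: T'_def)
qed

lemma graded_quasi_seed_initial:
  assumes "graded_quantum_seed scl mut (S, G)"
  shows "graded_quasi_seed scl mut S G"
  using assms
  unfolding graded_quantum_seed_def quantum_seed_def quantum_torus_fractions_def
      graded_quasi_seed_def quasi_commute_def matrix_vector_mult_def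
      prod.case vec_lambda_beta
  by blast

end

text \<open>Since the exchange matrix annihilates \<open>H\<close> in row \<open>k\<close>, the two
  exchange monomials have equal degree and their sum stays in one eigenspace.\<close>

lemma (in algebra_endomorphism) eigenspace_mutate:
  assumes T: "graded_quasi_seed scl mut T H" and k: "k \<in> mut"
    and X: "\<And>i. cluster T i \<in> eigenspace g (H $ i)"
  shows "cluster (mutate scl mut k T) i \<in> eigenspace g (mutate_grading (exmat T) k H $ i)"
proof (cases "i = k")
  case True
  have "toric_frame scl T a \<in> eigenspace g (monomial_degree a H)" for a
    unfolding toric_frame_def
    using T eigenspace_ordered_monomial[of "cluster T" H] subspace_eigenspace X
    by (intro subspace_scale) (simp_all add: graded_quasi_seed_def)
  moreover have "monomial_degree (b_plus (exmat T) k) H = monomial_degree (b_minus (exmat T) k) H"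
    using T k by (intro monomial_degree_b_plus) (simp_all add: graded_quasi_seed_def matrix_vector_mult_def)
  ultimately have "toric_frame scl T (b_plus (exmat T) k) + toric_frame scl T (b_minus (exmat T) k)
      \<in> eigenspace g (monomial_degree (b_minus (exmat T) k) H)"
    using subspace_eigenspace by (metis subspace_add)
  with True show ?thesis
    by (simp add: cluster_mutate mutate_grading_def)
next
  case False
  then show ?thesis
    using X by (simp add: cluster_mutate mutate_grading_def)
qed

text \<open>Cluster variables come from ungraded seeds and degrees from graded ones; a sequence of
  mutations lifts step by step.\<close>

lemma mutation_class_graded:
  "T \<in> mutation_class scl mut S \<Longrightarrow> \<exists>H. (T, H) \<in> graded_mutation_class scl mut (S, G)"
proof (induction rule: mutation_class.induct)
  case initial
  then show ?case
    using graded_mutation_class.initial by blast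
next
  case (step T k)
  then obtain H where "(T, H) \<in> graded_mutation_class scl mut (S, G)"
    by blast
  from graded_mutation_class.step[OF this step.hyps(2)] show ?case
    by (auto simp: mutate_graded_def)
qed

section \<open>The grading of the quantum cluster algebra\<close>

theorem corollary3p4:
  fixes scl :: "ground \<Rightarrow> 'f::division_ring \<Rightarrow> 'f"
    and mut :: "'n::{finite,linorder} set"
    and S :: "('n, 'f) qseed" and G :: "'n zvec"
  assumes "skew_field_algebra scl"
    and "graded_quantum_seed scl mut (S, G)"
  shows "\<exists>gr deg.
    is_Z_grading scl (quantum_cluster_algebra scl mut S) gr \<and>
    (\<forall>x \<in> quantum_cluster_variables scl mut S. x \<in> gr (deg x)) \<and>
    (\<forall>(T, H) \<in> graded_mutation_class scl mut (S, G). \<forall>i. deg (cluster T i) = H $ i)"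
proof -
  interpret skew_field_algebra scl
    by fact
  have torus: "quantum_torus_fractions scl (cluster S) (commat S)"
    using assms(2) by (simp add: graded_quantum_seed_def quantum_seed_def)
  obtain g where g: "\<And>x y. g (x + y) = g x + g y" "\<And>x y. g (x * y) = g x * g y"
      "\<And>c x. g (scl c x) = scl c (g x)"
      and gX: "\<And>i. g (cluster S i) = scl (qhalf powi (G $ i)) (cluster S i)"
    using eigenvalue_endomorphism_exists[OF torus, where G = G] by blast
  interpret algebra_endomorphism scl g
    by unfold_locales (rule g)+
  have initial: "graded_quasi_seed scl mut S G"
    using assms(2) by (rule graded_quasi_seed_initial)
  \<comment> \<open>Both properties are carried along together: preserving eigenvectors under
    mutation relies on the seed property of the current seed.\<close>
  have seed: "graded_quasi_seed scl mut (fst TH) (snd TH) \<and>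
      (\<forall>i. cluster (fst TH) i \<in> eigenspace g (snd TH $ i))"
    if "TH \<in> graded_mutation_class scl mut (S, G)" for TH
    using that
  proof (induction rule: graded_mutation_class.induct)
    case initial
    show ?case
      using \<open>graded_quasi_seed scl mut S G\<close> gX by (simp add: eigenspace_def)
  next
    case (step TH k)
    obtain T H where TH: "TH = (T, H)"
      by (cases TH)
    then have T: "graded_quasi_seed scl mut T H" "\<And>i. cluster T i \<in> eigenspace g (H $ i)"
      using step.IH by simp_all
    show ?case
      using graded_quasi_seed_mutate[OF T(1) step.hyps(2)] eigenspace_mutate[OF T(1) step.hyps(2) T(2)]
      by (simp add: TH mutate_graded_def)
  qed
  \<comment> \<open>For a cluster variable the choice is forced, since it is a nonzero eigenvector.
    So the propagated degree does not depend on the seed in which the variable occurs.\<close>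
  define deg where "deg x = (SOME d. x \<in> eigenspace g d)" for x
  have deg: "deg (cluster T i) = H $ i" "cluster T i \<in> eigenspace g (H $ i)"
    if "(T, H) \<in> graded_mutation_class scl mut (S, G)" for T H i
  proof -
    show mem: "cluster T i \<in> eigenspace g (H $ i)"
      using seed[OF that] by simp
    then have "cluster T i \<in> eigenspace g (deg (cluster T i))"
      unfolding deg_def by (rule someI)
    moreover have "cluster T i \<noteq> 0"
      using seed[OF that] by (simp add: graded_quasi_seed_def)
    ultimately show "deg (cluster T i) = H $ i"
      using mem eigenspace_unique by blast
  qed
  have homogeneous: "x \<in> eigenspace g (deg x)" if x: "x \<in> quantum_cluster_variables scl mut S" for x
  proof -
    obtain T i where T: "T \<in> mutation_class scl mut S" "x = cluster T i"
      using x by (auto simp: quantum_cluster_variables_def)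
    obtain H where "(T, H) \<in> graded_mutation_class scl mut (S, G)"
      using mutation_class_graded[OF T(1)] by blast
    from deg[OF this, of i] T(2) show ?thesis
      by simp
  qed
  \<comment> \<open>The index type is nonempty, so some initial variable is a nonzero eigenvector
    and 1 has degree 0.\<close>
  have "cluster S i \<noteq> 0" for i
    using initial by (simp add: graded_quasi_seed_def)
  then have "1 \<in> eigenspace g 0"
    using eigenspace_one gX by (auto simp: eigenspace_def)
  then have "is_Z_grading scl (quantum_cluster_algebra scl mut S)
      (\<lambda>d. eigenspace g d \<inter> quantum_cluster_algebra scl mut S)"
    unfolding quantum_cluster_algebra_def
    using homogeneous by (intro generated_subalgebra_graded_by_eigenspaces) blast+
  moreover have "x \<in> quantum_cluster_algebra scl mut S" if "x \<in> quantum_cluster_variables scl mut S" for x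
    using that generated_subalgebra_superset unfolding quantum_cluster_algebra_def by blast
  ultimately show ?thesis
    using homogeneous deg(1)
    by (intro exI[of _ "\<lambda>d. eigenspace g d \<inter> quantum_cluster_algebra scl mut S"] exI[of _ deg]) blast
qed

end
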